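(* Let $\mathcal{H}$ be a finite-dimensional complex Hilbert space, $\mathfrak{M}_D$ the set of density operators on $\mathcal{H}$, and let $d:\mathfrak{M}_D\times\mathfrak{M}_D\to\mathbb{R}$ be unitarily invariant and satisfy, for all $\rho,\sigma\in\mathfrak{M}_D$, $d(\rho,\sigma)\ge 0$ with $d(\rho,\sigma)=0$ if and only if $\rho=\sigma$. Let $\widetilde d$ be the unitarily residual measure of $d$ on $\mathfrak{M}_D/\!\sim$. Then for all $\rho,\sigma\in\mathfrak{M}_D$, $\widetilde d([\rho],[\sigma])\ge0$, with $\widetilde d([\rho],[\sigma])=0$ if and only if $[\rho]=[\sigma]$. Moreover, if $d$ is a metric on $\mathfrak{M}_D$ (i.e. it is also symmetric and satisfies the triangle inequality), then $\widetilde d$ is a metric on $\mathfrak{M}_D/\!\sim$.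
   Context: A density operator is a positive semidefinite operator of trace one. $\rho\sim\sigma$ means $\sigma=U\rho U^\dagger$ for some unitary $U$ on $\mathcal{H}$; $[\rho]$ is the equivalence class and $\mathfrak{M}_D/\!\sim$ the quotient set. Unitary invariance of $d$ means $d(U\rho U^\dagger,U\sigma U^\dagger)=d(\rho,\sigma)$ for every unitary $U$ and all $\rho,\sigma$. The unitarily residual measure of $d$ is $$\widetilde d([\rho],[\sigma]):=\min_{U,V\text{ unitary}}d(U\rho U^\dagger,V\sigma V^\dagger)=\min_{U\text{ unitary}}d(U\rho U^\dagger,\sigma)=\min_{U\text{ unitary}}d(\rho,U\sigma U^\dagger),$$ where it is assumed as part of the definition that the minimum is attained for all $\rho,\sigma$. *)

theory Defs
  imports Complex_Main
begin

text \<open>The inner product is conjugate-linear in its first and linear in its second argument.\<close>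

class complex_inner = ab_group_add +
  fixes scaleC :: "complex \<Rightarrow> 'a \<Rightarrow> 'a"
    and cinner :: "'a \<Rightarrow> 'a \<Rightarrow> complex"
  assumes scaleC_add_right: "scaleC a (x + y) = scaleC a x + scaleC a y"
    and scaleC_add_left: "scaleC (a + b) x = scaleC a x + scaleC b x"
    and scaleC_scaleC: "scaleC a (scaleC b x) = scaleC (a * b) x"
    and scaleC_one: "scaleC 1 x = x"
    and cinner_commute: "cinner x y = cnj (cinner y x)"
    and cinner_add_right: "cinner x (y + z) = cinner x y + cinner x z"
    and cinner_scaleC_right: "cinner x (scaleC a y) = a * cinner x y"
    and cinner_ge_zero: "0 \<le> Re (cinner x x)"
    and cinner_eq_zero_iff: "cinner x x = 0 \<longleftrightarrow> x = 0"

global_interpretation complex_vector: vector_space "scaleC :: complex \<Rightarrow> 'a \<Rightarrow> 'a::complex_inner"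
  by unfold_locales (simp_all add: scaleC_add_right scaleC_add_left scaleC_scaleC scaleC_one)

text \<open>Completeness is automatic in finite dimension and hence not required separately.\<close>

class finite_dim_hilbert = complex_inner +
  assumes finite_dim: "\<exists>B. finite B \<and> (\<forall>x. \<exists>c. x = (\<Sum>b\<in>B. scaleC (c b) b))"

definition clinear :: "('a::complex_inner \<Rightarrow> 'a) \<Rightarrow> bool" where
  "clinear A \<longleftrightarrow> Vector_Spaces.linear scaleC scaleC A"

definition cadjoint :: "('a::complex_inner \<Rightarrow> 'a) \<Rightarrow> 'a \<Rightarrow> 'a" where
  "cadjoint A = (THE B. \<forall>x y. cinner (A x) y = cinner x (B y))"

definition unitary :: "('a::complex_inner \<Rightarrow> 'a) \<Rightarrow> bool" where
  "unitary U \<longleftrightarrow> clinear U \<and> cadjoint U \<circ> U = id \<and> U \<circ> cadjoint U = id"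

definition conj_by :: "('a::complex_inner \<Rightarrow> 'a) \<Rightarrow> ('a \<Rightarrow> 'a) \<Rightarrow> 'a \<Rightarrow> 'a" where
  "conj_by U A = U \<circ> A \<circ> cadjoint U"

definition positive_semidefinite :: "('a::complex_inner \<Rightarrow> 'a) \<Rightarrow> bool" where
  "positive_semidefinite A \<longleftrightarrow>
     clinear A \<and> (\<forall>x. Im (cinner x (A x)) = 0 \<and> 0 \<le> Re (cinner x (A x)))"

text \<open>The trace is the sum of the diagonal entries of the matrix of the operator in a basis;
  it does not depend on the basis, so an arbitrary one is chosen.\<close>

definition some_basis :: "'a::finite_dim_hilbert set" where
  "some_basis = (SOME B. complex_vector.independent B \<and> complex_vector.span B = UNIV)"

definition ctrace :: "('a::finite_dim_hilbert \<Rightarrow> 'a) \<Rightarrow> complex" where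
  "ctrace A = (\<Sum>b\<in>some_basis. complex_vector.representation some_basis (A b) b)"

definition density_operators :: "('a::finite_dim_hilbert \<Rightarrow> 'a) set" where
  "density_operators = {\<rho>. positive_semidefinite \<rho> \<and> ctrace \<rho> = 1}"

definition unitary_equiv :: "(('a::finite_dim_hilbert \<Rightarrow> 'a) \<times> ('a \<Rightarrow> 'a)) set" where
  "unitary_equiv = {(\<rho>, \<sigma>). \<rho> \<in> density_operators \<and> \<sigma> \<in> density_operators \<and>
     (\<exists>U. unitary U \<and> \<sigma> = conj_by U \<rho>)}"

abbreviation unitary_class :: "('a::finite_dim_hilbert \<Rightarrow> 'a) \<Rightarrow> ('a \<Rightarrow> 'a) set" where
  "unitary_class \<rho> \<equiv> unitary_equiv `` {\<rho>}"

text \<open>A function \<open>d\<close> on pairs of density operators is represented by a function on all pairs of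
  maps; everything below only constrains and uses its values on density operators.\<close>

definition unitarily_invariant ::
    "(('a::finite_dim_hilbert \<Rightarrow> 'a) \<Rightarrow> ('a \<Rightarrow> 'a) \<Rightarrow> real) \<Rightarrow> bool" where
  "unitarily_invariant d \<longleftrightarrow>
     (\<forall>U. unitary U \<longrightarrow> (\<forall>\<rho>\<in>density_operators. \<forall>\<sigma>\<in>density_operators.
        d (conj_by U \<rho>) (conj_by U \<sigma>) = d \<rho> \<sigma>))"

definition residual_attained ::
    "(('a::finite_dim_hilbert \<Rightarrow> 'a) \<Rightarrow> ('a \<Rightarrow> 'a) \<Rightarrow> real) \<Rightarrow> bool" where
  "residual_attained d \<longleftrightarrow>
     (\<forall>\<rho>\<in>density_operators. \<forall>\<sigma>\<in>density_operators.
        \<exists>U V. unitary U \<and> unitary V \<and>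
          (\<forall>U' V'. unitary U' \<longrightarrow> unitary V' \<longrightarrow>
             d (conj_by U \<rho>) (conj_by V \<sigma>) \<le> d (conj_by U' \<rho>) (conj_by V' \<sigma>)))"

text \<open>The minimum over \<open>U\<close> and \<open>V\<close> of \<open>d (U \<rho> U\<^sup>\<dagger>) (V \<sigma> V\<^sup>\<dagger>)\<close> is the same for all
  representatives \<open>\<rho>\<close> of \<open>X\<close> and \<open>\<sigma>\<close> of \<open>Y\<close>, so letting these vary as well does not change it.
  It is meaningful under \<open>residual_attained d\<close>.\<close>

definition unitary_residual ::
    "(('a::finite_dim_hilbert \<Rightarrow> 'a) \<Rightarrow> ('a \<Rightarrow> 'a) \<Rightarrow> real)
      \<Rightarrow> ('a \<Rightarrow> 'a) set \<Rightarrow> ('a \<Rightarrow> 'a) set \<Rightarrow> real" where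
  "unitary_residual d X Y =
     (LEAST r. \<exists>\<rho>\<in>density_operators. \<exists>\<sigma>\<in>density_operators. \<exists>U V.
        X = unitary_class \<rho> \<and> Y = unitary_class \<sigma> \<and> unitary U \<and> unitary V \<and>
        r = d (conj_by U \<rho>) (conj_by V \<sigma>))"

text \<open>Unlike the locale \<open>Metric_space\<close> of HOL-Analysis, which demands nonnegativity and symmetry
  on the whole type, this constrains \<open>d\<close> on \<open>S\<close> only.\<close>

definition metric_on :: "'b set \<Rightarrow> ('b \<Rightarrow> 'b \<Rightarrow> real) \<Rightarrow> bool" where
  "metric_on S d \<longleftrightarrow>
     (\<forall>x\<in>S. \<forall>y\<in>S. 0 \<le> d x y) \<and>
     (\<forall>x\<in>S. \<forall>y\<in>S. d x y = 0 \<longleftrightarrow> x = y) \<and>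
     (\<forall>x\<in>S. \<forall>y\<in>S. d x y = d y x) \<and>
     (\<forall>x\<in>S. \<forall>y\<in>S. \<forall>z\<in>S. d x z \<le> d x y + d y z)"

end

theory Submission
  imports Defs
begin

text \<open>Unitary conjugation is a group action on the density operators: adjoints exist by expansion in
  an orthonormal basis, and the trace is invariant because \<open>tr (A B) = tr (B A)\<close>. The residual
  measure of two classes is therefore the minimum of \<open>d\<close> over their elements. A zero minimum
  means that the classes meet. For the triangle inequality, take minimizing pairs \<open>(a, b)\<close> for
  \<open>X, Y\<close> and \<open>(b', c)\<close> for \<open>Y, Z\<close>, and move \<open>b'\<close> to \<open>b\<close> by a unitary.\<close>

section \<open>Inner products and adjoints\<close>

lemma cinner_add_left: "cinner (x + y) z = cinner x z + cinner (y::'a::complex_inner) z"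
  by (metis cinner_add_right cinner_commute complex_cnj_add)

lemma cinner_scaleC_left: "cinner (scaleC a x) y = cnj a * cinner (x::'a::complex_inner) y"
  by (metis cinner_scaleC_right cinner_commute complex_cnj_mult)

lemma cinner_zero_right [simp]: "cinner (x::'a::complex_inner) 0 = 0"
  using cinner_add_right[of x 0 0] by simp

lemma cinner_zero_left [simp]: "cinner 0 (x::'a::complex_inner) = 0"
  using cinner_add_left[of 0 0 x] by simp

lemma cinner_diff_right: "cinner (x::'a::complex_inner) (y - z) = cinner x y - cinner x z"
  using cinner_add_right[of x "y - z" z] by simp

lemma cinner_sum_right: "cinner (x::'a::complex_inner) (sum f S) = (\<Sum>i\<in>S. cinner x (f i))"
  by (induction S rule: infinite_finite_induct) (simp_all add: cinner_add_right)

lemma cinner_sum_left: "cinner (sum f S) (x::'a::complex_inner) = (\<Sum>i\<in>S. cinner (f i) x)"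
  by (induction S rule: infinite_finite_induct) (simp_all add: cinner_add_left)

lemma cinner_extensional:
  assumes "\<And>x. cinner x u = cinner x (v::'a::complex_inner)"
  shows "u = v"
proof -
  have "cinner (u - v) (u - v) = 0"
    using assms by (simp add: cinner_diff_right)
  then show ?thesis
    by (simp add: cinner_eq_zero_iff)
qed

section \<open>Orthonormal sets and expansions\<close>

lemma exists_unit_multiple:
  assumes "w \<noteq> (0::'a::complex_inner)"
  obtains k where "k \<noteq> 0" "cinner (scaleC k w) (scaleC k w) = 1"
proof
  define r where "r = Re (cinner w w)"
  \<comment> \<open>Conjugate symmetry makes \<open>cinner w w\<close> its own conjugate, so it is
    the real number \<open>r\<close>. Definiteness makes \<open>r\<close> positive, and the
    normalizing factor is \<open>1 / sqrt r\<close>.\<close>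
  have im: "Im (cinner w w) = 0"
    using cinner_commute[of w w] by (metis cnj.simps(2) equal_neg_zero)
  have w: "cinner w w = complex_of_real r"
    by (simp add: r_def complex_eq_iff im)
  have r: "r > 0"
    using assms cinner_ge_zero[of w] w cinner_eq_zero_iff[of w] unfolding r_def[symmetric]
    by (cases "r = 0") auto
  let ?k = "complex_of_real (1 / sqrt r)"
  show "?k \<noteq> 0"
    using r by simp
  have "cinner (scaleC ?k w) (scaleC ?k w) = complex_of_real (1 / sqrt r * (1 / sqrt r) * r)"
    by (simp only: cinner_scaleC_left cinner_scaleC_right w complex_cnj_complex_of_real
        of_real_mult mult.assoc)
  also have "1 / sqrt r * (1 / sqrt r) * r = 1"
    using r by (simp add: field_simps)
  finally show "cinner (scaleC ?k w) (scaleC ?k w) = 1"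
    by simp
qed

definition orthonormal :: "'a::complex_inner set \<Rightarrow> bool" where
  "orthonormal E \<longleftrightarrow> (\<forall>e\<in>E. \<forall>f\<in>E. cinner e f = (if e = f then 1 else 0))"

text \<open>Each new \<open>b\<close> is replaced by its component \<open>b - p\<close> orthogonal
  to the span built so far. \<open>B\<close> may be linearly dependent: a zero component means that
  \<open>b\<close> is already spanned and \<open>E\<close> is kept; otherwise the normalized
  component joins \<open>E\<close>.\<close>

lemma gram_schmidt:
  assumes "finite (B::'a::complex_inner set)"
  shows "\<exists>E. finite E \<and> orthonormal E \<and> B \<subseteq> complex_vector.span E"
  using assms
proof induction
  case empty
  show ?case
    by (rule exI[of _ "{}"]) (simp add: orthonormal_def)
next
  case (insert b B)
  then obtain E where E: "finite E" "orthonormal E" "B \<subseteq> complex_vector.span E"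
    by blast
  \<comment> \<open>The orthogonal projection of \<open>b\<close> onto the span of
    \<open>E\<close>.\<close>
  define p where "p = (\<Sum>e\<in>E. scaleC (cinner e b) e)"
  have p: "p \<in> complex_vector.span E"
    unfolding p_def
    by (intro complex_vector.span_sum complex_vector.span_scale complex_vector.span_base)
  have orth: "cinner e (b - p) = 0" if "e \<in> E" for e
  proof -
    have "cinner e p = (\<Sum>f\<in>E. cinner f b * cinner e f)"
      by (simp add: p_def cinner_sum_right cinner_scaleC_right)
    also have "\<dots> = (\<Sum>f\<in>E. if e = f then cinner f b else 0)"
      using that E(2) by (intro sum.cong) (auto simp: orthonormal_def)
    also have "\<dots> = cinner e b"
      using that E(1) by simp
    finally show ?thesis
      by (simp add: cinner_diff_right)
  qed
  show ?case
  proof (cases "b - p = 0")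
    case True
    then show ?thesis
      using E p by auto
  next
    case False
    then obtain k where k: "k \<noteq> 0" "cinner (scaleC k (b - p)) (scaleC k (b - p)) = 1"
      by (rule exists_unit_multiple)
    define u where "u = scaleC k (b - p)"
    have eu: "cinner e u = 0" "cinner u e = 0" if "e \<in> E" for e
      using orth[OF that] cinner_commute[of u e] by (simp_all add: u_def cinner_scaleC_right)
    have on: "orthonormal (insert u E)"
      using E(2) eu k(2) unfolding orthonormal_def by (auto simp: u_def)
    have sub: "complex_vector.span E \<subseteq> complex_vector.span (insert u E)"
      by (rule complex_vector.span_mono) auto
    have "scaleC (1 / k) u \<in> complex_vector.span (insert u E)"
      by (intro complex_vector.span_scale complex_vector.span_base) simp
    moreover have "b = scaleC (1 / k) u + p"
      using k(1) by (simp add: u_def)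
    ultimately have "b \<in> complex_vector.span (insert u E)"
      using p sub by (metis complex_vector.span_add subsetD)
    then show ?thesis
      using E on sub by (intro exI[of _ "insert u E"]) auto
  qed
qed

lemma finite_spanning_set:
  obtains B :: "'a::finite_dim_hilbert set" where "finite B" "complex_vector.span B = UNIV"
proof -
  obtain B :: "'a set" where B: "finite B" "\<forall>x. \<exists>c. x = (\<Sum>b\<in>B. scaleC (c b) b)"
    using finite_dim by blast
  have "x \<in> complex_vector.span B" for x
  proof -
    obtain c where "x = (\<Sum>b\<in>B. scaleC (c b) b)"
      using B(2) by blast
    then show ?thesis
      by (simp add: complex_vector.span_sum complex_vector.span_scale complex_vector.span_base)
  qed
  then show ?thesis
    using B(1) that by blast
qed

text \<open>Gram-Schmidt turns a finite spanning set into an orthonormal one; pairing any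
  representation of \<open>x\<close> with \<open>e\<close> then identifies the coefficient of
  \<open>e\<close>.\<close>

lemma orthonormal_expansion:
  obtains E :: "'a::finite_dim_hilbert set"
  where "finite E" "\<And>x. x = (\<Sum>e\<in>E. scaleC (cinner e x) e)"
proof -
  obtain B :: "'a set" where B: "finite B" "complex_vector.span B = UNIV"
    by (rule finite_spanning_set)
  obtain E where E: "finite E" "orthonormal E" "B \<subseteq> complex_vector.span E"
    using gram_schmidt[OF B(1)] by blast
  have span: "complex_vector.span E = UNIV"
    using complex_vector.span_minimal[OF E(3) complex_vector.subspace_span] B(2) by auto
  have "x = (\<Sum>e\<in>E. scaleC (cinner e x) e)" for x
  proof -
    obtain c where x: "x = (\<Sum>e\<in>E. scaleC (c e) e)"
      using span complex_vector.span_finite[OF E(1)] by blast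
    have "cinner e x = c e" if "e \<in> E" for e
    proof -
      have "cinner e x = (\<Sum>f\<in>E. c f * cinner e f)"
        by (simp add: x cinner_sum_right cinner_scaleC_right)
      also have "\<dots> = (\<Sum>f\<in>E. if e = f then c f else 0)"
        using that E(2) by (intro sum.cong) (auto simp: orthonormal_def)
      finally show ?thesis
        using that E(1) by simp
    qed
    then have "(\<Sum>e\<in>E. scaleC (cinner e x) e) = (\<Sum>e\<in>E. scaleC (c e) e)"
      by (intro sum.cong) auto
    then show ?thesis
      by (simp only: x[symmetric])
  qed
  then show ?thesis
    by (rule that[OF E(1)])
qed

section \<open>Linear maps and existence of adjoints\<close>

lemma clinear_iff:
  "clinear A \<longleftrightarrow> (\<forall>x y. A (x + y) = A x + A y) \<and> (\<forall>c x. A (scaleC c x) = scaleC c (A x))"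
  unfolding clinear_def Vector_Spaces.linear_iff
  by (auto simp: complex_vector.vector_space_axioms)

lemma clinear_sum:
  assumes "clinear A"
  shows "A (sum f S) = (\<Sum>i\<in>S. A (f i))"
proof -
  interpret Vector_Spaces.linear scaleC scaleC A
    using assms by (simp add: clinear_def)
  show ?thesis
    by (rule sum)
qed

lemma clinear_comp: "clinear A \<Longrightarrow> clinear B \<Longrightarrow> clinear (A \<circ> B)"
  by (simp add: clinear_iff)

text \<open>The inner product separates vectors, so at most one map satisfies the adjoint identity,
  and the definite description denotes it once one is exhibited.\<close>

lemma cadjoint_eqI:
  assumes "\<And>x y. cinner (A x) y = cinner x (B y)"
  shows "cadjoint A = B"
  unfolding cadjoint_def
proof (rule the_equality)
  show "C = B" if "\<forall>x y. cinner (A x) y = cinner x (C y)" for C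
    using that assms by (intro ext cinner_extensional) metis
qed (simp add: assms)

text \<open>This is the existence of the adjoint, which gives the definite description in
  \<open>cadjoint\<close> its meaning. Finite dimension enters through the orthonormal
  expansion.\<close>

lemma cinner_cadjoint_right:
  fixes A :: "'a::finite_dim_hilbert \<Rightarrow> 'a"
  assumes "clinear A"
  shows "cinner x (cadjoint A y) = cinner (A x) y"
proof -
  obtain E :: "'a set" where E: "finite E" "\<And>x. x = (\<Sum>e\<in>E. scaleC (cinner e x) e)"
    by (rule orthonormal_expansion) blast
  \<comment> \<open>Forced by the expansion of \<open>B y\<close>: the coefficient at
    \<open>e\<close> is \<open>cinner e (B y)\<close>, which has to equal
    \<open>cinner (A e) y\<close>.\<close>
  define B where "B y = (\<Sum>e\<in>E. scaleC (cinner (A e) y) e)" for y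
  have adj: "cinner (A x) y = cinner x (B y)" for x y
  proof -
    have "A x = A (\<Sum>e\<in>E. scaleC (cinner e x) e)"
      by (rule arg_cong[OF E(2)])
    also have "\<dots> = (\<Sum>e\<in>E. scaleC (cinner e x) (A e))"
      using assms by (simp add: clinear_sum) (simp add: clinear_iff)
    \<comment> \<open>Conjugate-linearity in the first argument turns the coefficient
      \<open>cinner e x\<close> into \<open>cinner x e\<close>.\<close>
    finally have "cinner (A x) y = (\<Sum>e\<in>E. cinner x e * cinner (A e) y)"
      by (simp add: cinner_sum_left cinner_scaleC_left cinner_commute[of x])
    then show ?thesis
      by (simp add: B_def cinner_sum_right cinner_scaleC_right mult.commute)
  qed
  then show ?thesis
    using cadjoint_eqI[of A B] by simp
qed

lemma cinner_cadjoint_left: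
  fixes A :: "'a::finite_dim_hilbert \<Rightarrow> 'a"
  assumes "clinear A"
  shows "cinner (cadjoint A x) y = cinner x (A y)"
  using cinner_cadjoint_right[OF assms, of y x] by (metis cinner_commute)

lemma clinear_cadjoint:
  fixes A :: "'a::finite_dim_hilbert \<Rightarrow> 'a"
  assumes "clinear A"
  shows "clinear (cadjoint A)"
  unfolding clinear_iff
proof (intro conjI allI)
  show "cadjoint A (x + y) = cadjoint A x + cadjoint A y" for x y
    by (rule cinner_extensional) (simp add: cinner_cadjoint_right[OF assms] cinner_add_right)
  show "cadjoint A (scaleC c x) = scaleC c (cadjoint A x)" for c x
    by (rule cinner_extensional) (simp add: cinner_cadjoint_right[OF assms] cinner_scaleC_right)
qed

lemma cadjoint_cadjoint:
  fixes A :: "'a::finite_dim_hilbert \<Rightarrow> 'a"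
  shows "clinear A \<Longrightarrow> cadjoint (cadjoint A) = A"
  by (rule cadjoint_eqI) (rule cinner_cadjoint_left)

lemma cadjoint_comp:
  fixes A B :: "'a::finite_dim_hilbert \<Rightarrow> 'a"
  shows "clinear A \<Longrightarrow> clinear B \<Longrightarrow> cadjoint (A \<circ> B) = cadjoint B \<circ> cadjoint A"
  by (rule cadjoint_eqI) (simp add: cinner_cadjoint_right)

section \<open>The trace\<close>

text \<open>A maximal independent subset of the whole space spans it, so the choice in the
  definition has a witness.\<close>

lemma some_basis:
  "complex_vector.independent (some_basis :: 'a::finite_dim_hilbert set)"
  "complex_vector.span (some_basis :: 'a set) = UNIV"
proof -
  obtain B :: "'a set" where "complex_vector.independent B" "UNIV \<subseteq> complex_vector.span B"
    using complex_vector.maximal_independent_subset[of UNIV] by blast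
  then have "\<exists>B :: 'a set. complex_vector.independent B \<and> complex_vector.span B = UNIV"
    by blast
  from someI_ex[OF this]
  show "complex_vector.independent (some_basis :: 'a set)"
    "complex_vector.span (some_basis :: 'a set) = UNIV"
    by (simp_all add: some_basis_def)
qed

lemma finite_some_basis: "finite (some_basis :: 'a::finite_dim_hilbert set)"
proof -
  obtain B :: "'a set" where "finite B" "complex_vector.span B = UNIV"
    by (rule finite_spanning_set)
  then show ?thesis
    using complex_vector.independent_span_bound[of B some_basis] some_basis(1) by auto
qed

text \<open>In coordinates with respect to \<open>some_basis\<close> both traces are the same double
  sum of products of matrix entries, up to the order of summation.\<close>

lemma ctrace_comp_commute:
  fixes A B :: "'a::finite_dim_hilbert \<Rightarrow> 'a"
  assumes "clinear A" "clinear B"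
  shows "ctrace (A \<circ> B) = ctrace (B \<circ> A)"
proof -
  let ?S = "some_basis :: 'a set"
  let ?r = "complex_vector.representation ?S"
  \<comment> \<open>Matrix times coordinate vector: \<open>?r (A c) b\<close> is the entry of
    \<open>A\<close> in row \<open>b\<close> and column \<open>c\<close>.\<close>
  have rep: "?r (A v) b = (\<Sum>c\<in>?S. ?r v c * ?r (A c) b)" if "clinear A" for A v b
  proof -
    have "v = (\<Sum>c\<in>?S. scaleC (?r v c) c)"
      by (rule complex_vector.sum_representation_eq[symmetric])
        (simp_all add: some_basis finite_some_basis)
    then have "A v = A (\<Sum>c\<in>?S. scaleC (?r v c) c)"
      by (rule arg_cong)
    also have "\<dots> = (\<Sum>c\<in>?S. scaleC (?r v c) (A c))"
      using that by (simp add: clinear_sum) (simp add: clinear_iff)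
    finally have "?r (A v) b = ?r (\<Sum>c\<in>?S. scaleC (?r v c) (A c)) b"
      by simp
    also have "\<dots> = (\<Sum>c\<in>?S. ?r (scaleC (?r v c) (A c)) b)"
      using some_basis by (subst complex_vector.representation_sum) auto
    also have "\<dots> = (\<Sum>c\<in>?S. ?r v c * ?r (A c) b)"
      by (intro sum.cong refl, subst complex_vector.representation_scale)
        (simp_all add: some_basis)
    finally show ?thesis .
  qed
  have "ctrace (A \<circ> B) = (\<Sum>b\<in>?S. \<Sum>c\<in>?S. ?r (B b) c * ?r (A c) b)"
    by (simp add: ctrace_def rep[OF assms(1), of "B _"])
  also have "\<dots> = (\<Sum>c\<in>?S. \<Sum>b\<in>?S. ?r (A c) b * ?r (B b) c)"
    by (subst sum.swap) (simp add: mult.commute)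
  also have "\<dots> = ctrace (B \<circ> A)"
    by (simp add: ctrace_def rep[OF assms(2), of "A _"])
  finally show ?thesis .
qed

section \<open>The unitary action\<close>

lemma unitary_id: "unitary (id :: 'a::finite_dim_hilbert \<Rightarrow> 'a)"
  and cadjoint_id: "cadjoint (id :: 'a \<Rightarrow> 'a) = id"
proof -
  show "cadjoint (id :: 'a \<Rightarrow> 'a) = id"
    by (rule cadjoint_eqI) simp
  then show "unitary (id :: 'a \<Rightarrow> 'a)"
    by (simp add: unitary_def clinear_iff)
qed

lemma unitary_cadjoint:
  "unitary (U :: 'a::finite_dim_hilbert \<Rightarrow> 'a) \<Longrightarrow> unitary (cadjoint U)"
  by (simp add: unitary_def clinear_cadjoint cadjoint_cadjoint)

lemma unitary_comp:
  fixes U V :: "'a::finite_dim_hilbert \<Rightarrow> 'a"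
  shows "unitary U \<Longrightarrow> unitary V \<Longrightarrow> unitary (U \<circ> V)"
  by (simp add: unitary_def clinear_comp cadjoint_comp fun_eq_iff)

lemma conj_by_id: "conj_by id (A :: 'a::finite_dim_hilbert \<Rightarrow> 'a) = A"
  by (simp add: conj_by_def cadjoint_id)

lemma conj_by_comp:
  fixes U V :: "'a::finite_dim_hilbert \<Rightarrow> 'a"
  shows "unitary U \<Longrightarrow> unitary V \<Longrightarrow> conj_by (U \<circ> V) A = conj_by U (conj_by V A)"
  by (simp add: unitary_def conj_by_def cadjoint_comp o_assoc)

text \<open>The adjoint of a unitary acts as its inverse; this gives the symmetry of
  \<open>unitary_equiv\<close>.\<close>

lemma conj_by_cadjoint_conj_by:
  fixes U :: "'a::finite_dim_hilbert \<Rightarrow> 'a"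
  assumes "unitary U"
  shows "conj_by (cadjoint U) (conj_by U A) = A"
  using conj_by_comp[OF unitary_cadjoint[OF assms] assms, of A] assms
  by (simp add: unitary_def conj_by_id)

text \<open>Moving \<open>U\<close> across the inner product turns the quadratic form of the
  conjugate at \<open>x\<close> into that of \<open>\<rho>\<close> at \<open>cadjoint U x\<close>.
  For the trace, cyclicity brings \<open>cadjoint U\<close> next to \<open>U\<close>, where the two
  cancel.\<close>

lemma conj_by_density:
  fixes U :: "'a::finite_dim_hilbert \<Rightarrow> 'a"
  assumes U: "unitary U" and \<rho>: "\<rho> \<in> density_operators"
  shows "conj_by U \<rho> \<in> density_operators"
proof -
  have lin: "clinear U" "clinear (cadjoint U)" "clinear \<rho>"
    using U \<rho>
    by (auto simp: unitary_def density_operators_def positive_semidefinite_def clinear_cadjoint)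
  have "cinner x (conj_by U \<rho> x) = cinner (cadjoint U x) (\<rho> (cadjoint U x))" for x
    by (simp add: conj_by_def cinner_cadjoint_left[OF lin(1)])
  then have pos: "positive_semidefinite (conj_by U \<rho>)"
    using \<rho> lin
    by (simp add: positive_semidefinite_def density_operators_def conj_by_def clinear_comp)
  have "ctrace (conj_by U \<rho>) = ctrace (cadjoint U \<circ> (U \<circ> \<rho>))"
    unfolding conj_by_def by (rule ctrace_comp_commute) (simp_all add: lin clinear_comp)
  also have "cadjoint U \<circ> (U \<circ> \<rho>) = \<rho>"
    using U by (simp add: unitary_def o_assoc)
  finally show ?thesis
    using pos \<rho> by (simp add: density_operators_def)
qed

text \<open>Reflexivity, symmetry and transitivity come from the identity, inverses and products of
  unitaries.\<close>

lemma equiv_unitary_equiv: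
  "equiv density_operators (unitary_equiv :: (('a::finite_dim_hilbert \<Rightarrow> 'a) \<times> ('a \<Rightarrow> 'a)) set)"
proof (rule equivI)
  show "unitary_equiv \<subseteq> density_operators \<times> density_operators"
    by (auto simp: unitary_equiv_def)
  show "refl_on density_operators unitary_equiv"
    unfolding refl_on_def unitary_equiv_def using unitary_id conj_by_id[symmetric] by blast
  show "sym unitary_equiv"
    unfolding unitary_equiv_def
    by (rule symI) (use unitary_cadjoint conj_by_cadjoint_conj_by in fastforce)
  show "trans unitary_equiv"
    unfolding unitary_equiv_def trans_def using unitary_comp conj_by_comp[symmetric] by blast
qed

text \<open>Conjugates of a density operator are again density operators, so the class is the full
  unitary orbit.\<close>

lemma mem_unitary_class_iff:
  assumes "\<rho> \<in> density_operators"
  shows "a \<in> unitary_class \<rho> \<longleftrightarrow> (\<exists>U. unitary U \<and> a = conj_by U \<rho>)"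
  using assms conj_by_density by (auto simp: unitary_equiv_def)

section \<open>The residual measure\<close>

text \<open>As classes are orbits, ranging over representatives and unitaries amounts to ranging
  over the elements of \<open>X\<close> and \<open>Y\<close>. Attainment and the lower bound are all
  that later proofs use of \<open>unitary_residual\<close>.\<close>

lemma unitary_residual_minimum:
  assumes "residual_attained d"
    and X: "X \<in> density_operators // unitary_equiv"
    and Y: "Y \<in> density_operators // unitary_equiv"
  shows unitary_residual_attained:
      "\<exists>a\<in>X. \<exists>b\<in>Y. unitary_residual d X Y = d a b"
    and unitary_residual_le:
      "a \<in> X \<Longrightarrow> b \<in> Y \<Longrightarrow> unitary_residual d X Y \<le> d a b"
proof -
  obtain \<rho> \<sigma> where \<rho>: "\<rho> \<in> density_operators" "X = unitary_class \<rho>"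
    and \<sigma>: "\<sigma> \<in> density_operators" "Y = unitary_class \<sigma>"
    using X Y by (auto elim!: quotientE)
  have residual:
    "unitary_residual d X Y = (LEAST r. \<exists>a\<in>X. \<exists>b\<in>Y. r = d a b)"
  proof -
    have "(\<exists>\<rho>\<in>density_operators. \<exists>\<sigma>\<in>density_operators. \<exists>U V.
        X = unitary_class \<rho> \<and> Y = unitary_class \<sigma> \<and> unitary U \<and> unitary V \<and>
        r = d (conj_by U \<rho>) (conj_by V \<sigma>)) \<longleftrightarrow> (\<exists>a\<in>X. \<exists>b\<in>Y. r = d a b)" (is "?l \<longleftrightarrow> ?r") for r
    proof
      assume ?l
      then show ?r
        using mem_unitary_class_iff by blast
    next
      \<comment> \<open>The fixed representatives \<open>\<rho>\<close> and \<open>\<sigma>\<close>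
        serve for every pair \<open>a\<close>, \<open>b\<close>.\<close>
      assume ?r
      then show ?l
        using \<rho> \<sigma> mem_unitary_class_iff by metis
    qed
    then show ?thesis
      by (simp add: unitary_residual_def)
  qed
  obtain U V where UV: "unitary U" "unitary V"
    "\<And>U' V'. unitary U' \<Longrightarrow> unitary V' \<Longrightarrow>
      d (conj_by U \<rho>) (conj_by V \<sigma>) \<le> d (conj_by U' \<rho>) (conj_by V' \<sigma>)"
    using assms(1) \<rho>(1) \<sigma>(1) unfolding residual_attained_def by metis
  have in_class: "conj_by U \<rho> \<in> X" "conj_by V \<sigma> \<in> Y"
    using UV \<rho> \<sigma> mem_unitary_class_iff by blast+
  have le: "d (conj_by U \<rho>) (conj_by V \<sigma>) \<le> d a b" if "a \<in> X" "b \<in> Y" for a b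
    using that UV(3) \<rho> \<sigma> mem_unitary_class_iff by metis
  \<comment> \<open>\<open>LEAST\<close> over the reals is determined only once a least element is
    exhibited; the attained minimum provides it.\<close>
  have eq: "unitary_residual d X Y = d (conj_by U \<rho>) (conj_by V \<sigma>)"
    unfolding residual by (rule Least_equality) (use in_class le in auto)
  show "\<exists>a\<in>X. \<exists>b\<in>Y. unitary_residual d X Y = d a b"
    using eq in_class by blast
  show "unitary_residual d X Y \<le> d a b" if "a \<in> X" "b \<in> Y"
    using eq le[OF that] by simp
qed

text \<open>The two minimizing pairs may have different middle operators in \<open>Y\<close>.
  Translating the second pair by a unitary aligns them and, by invariance, leaves its value of
  \<open>d\<close> unchanged.\<close>

lemma unitary_residual_triangle:
  assumes inv: "unitarily_invariant d" and att: "residual_attained d"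
    and tri: "\<And>a b c. a \<in> density_operators \<Longrightarrow> b \<in> density_operators \<Longrightarrow>
      c \<in> density_operators \<Longrightarrow> d a c \<le> d a b + d b c"
    and X: "X \<in> density_operators // unitary_equiv"
    and Y: "Y \<in> density_operators // unitary_equiv"
    and Z: "Z \<in> density_operators // unitary_equiv"
  shows "unitary_residual d X Z \<le> unitary_residual d X Y + unitary_residual d Y Z"
proof -
  note sub = in_quotient_imp_subset[OF equiv_unitary_equiv]
  obtain a b where ab: "a \<in> X" "b \<in> Y" "unitary_residual d X Y = d a b"
    using unitary_residual_attained[OF att X Y] by blast
  obtain b' c where bc: "b' \<in> Y" "c \<in> Z" "unitary_residual d Y Z = d b' c"
    using unitary_residual_attained[OF att Y Z] by blast
  have D: "a \<in> density_operators" "b \<in> density_operators" "b' \<in> density_operators"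
    "c \<in> density_operators"
    using ab bc sub X Y Z by blast+
  have "(b', b) \<in> unitary_equiv"
    using quotient_eq_iff[OF equiv_unitary_equiv Y Y bc(1) ab(2)] by simp
  then obtain W where W: "unitary W" "b = conj_by W b'"
    by (auto simp: unitary_equiv_def)
  have WcD: "conj_by W c \<in> density_operators"
    by (rule conj_by_density[OF W(1) D(4)])
  then have "(c, conj_by W c) \<in> unitary_equiv"
    using W(1) D(4) by (auto simp: unitary_equiv_def)
  \<comment> \<open>Staying in \<open>Z\<close> makes \<open>a\<close> and
    \<open>conj_by W c\<close> a competing pair for the minimum over \<open>X\<close> and
    \<open>Z\<close>.\<close>
  then have "conj_by W c \<in> Z"
    using in_quotient_imp_closed[OF equiv_unitary_equiv Z bc(2)] by blast
  then have "unitary_residual d X Z \<le> d a (conj_by W c)"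
    using unitary_residual_le[OF att X Z ab(1)] by blast
  also have "\<dots> \<le> d a b + d b (conj_by W c)"
    by (rule tri[OF D(1,2) WcD])
  also have "d b (conj_by W c) = d b' c"
    using inv W D by (simp add: unitarily_invariant_def)
  finally show ?thesis
    using ab bc by simp
qed

text \<open>A minimizing pair for one order of the classes, reversed, competes in the other order.
  This gives one inequality for arbitrary classes, and exchanging them gives the other.\<close>

lemma unitary_residual_commute:
  assumes att: "residual_attained d"
    and sym: "\<And>a b. a \<in> density_operators \<Longrightarrow> b \<in> density_operators \<Longrightarrow> d a b = d b a"
    and X: "X \<in> density_operators // unitary_equiv"
    and Y: "Y \<in> density_operators // unitary_equiv"
  shows "unitary_residual d X Y = unitary_residual d Y X"
proof -
  have "unitary_residual d X Y \<le> unitary_residual d Y X"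
    if X: "X \<in> density_operators // unitary_equiv"
      and Y: "Y \<in> density_operators // unitary_equiv" for X Y
  proof -
    obtain b a where ba: "b \<in> Y" "a \<in> X" "unitary_residual d Y X = d b a"
      using unitary_residual_attained[OF att Y X] by blast
    then have "d b a = d a b"
      using sym X Y in_quotient_imp_subset[OF equiv_unitary_equiv] by blast
    then show ?thesis
      using unitary_residual_le[OF att X Y ba(2,1)] ba(3) by simp
  qed
  then show ?thesis
    using X Y by (simp add: order_antisym)
qed

theorem mainTheorem2:
  fixes d :: "('a::finite_dim_hilbert \<Rightarrow> 'a) \<Rightarrow> ('a \<Rightarrow> 'a) \<Rightarrow> real"
  assumes invariant: "unitarily_invariant d"
    and nonneg: "\<And>\<rho> \<sigma>. \<rho> \<in> density_operators \<Longrightarrow> \<sigma> \<in> density_operators \<Longrightarrow> 0 \<le> d \<rho> \<sigma>"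
    and zero_iff: "\<And>\<rho> \<sigma>. \<rho> \<in> density_operators \<Longrightarrow> \<sigma> \<in> density_operators \<Longrightarrow>
      d \<rho> \<sigma> = 0 \<longleftrightarrow> \<rho> = \<sigma>"
    and attained: "residual_attained d"
  shows "(\<forall>\<rho>\<in>density_operators. \<forall>\<sigma>\<in>density_operators.
           0 \<le> unitary_residual d (unitary_class \<rho>) (unitary_class \<sigma>) \<and>
           (unitary_residual d (unitary_class \<rho>) (unitary_class \<sigma>) = 0
              \<longleftrightarrow> unitary_class \<rho> = unitary_class \<sigma>)) \<and>
         (metric_on density_operators d \<longrightarrow>
           metric_on (density_operators // unitary_equiv) (unitary_residual d))"
proof -
  let ?Q = "density_operators // unitary_equiv :: ('a \<Rightarrow> 'a) set set"
  note sub = in_quotient_imp_subset[OF equiv_unitary_equiv]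
  have pos: "0 \<le> unitary_residual d X Y" if "X \<in> ?Q" "Y \<in> ?Q" for X Y
    using unitary_residual_attained[OF attained that] nonneg sub that by (metis subsetD)
  have zero: "unitary_residual d X Y = 0 \<longleftrightarrow> X = Y" if X: "X \<in> ?Q" and Y: "Y \<in> ?Q" for X Y
  proof
    assume 0: "unitary_residual d X Y = 0"
    obtain a b where ab: "a \<in> X" "b \<in> Y" "unitary_residual d X Y = d a b"
      using unitary_residual_attained[OF attained X Y] by blast
    then have "a = b"
      using 0 zero_iff[of a b] sub X Y by auto
    then show "X = Y"
      \<comment> \<open>The common element \<open>a = b\<close> lies in both classes, and distinct
        classes are disjoint.\<close>
      using ab quotient_disj[OF equiv_unitary_equiv X Y] by blast
  next
    assume "X = Y"
    obtain a where a: "a \<in> X"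
      using in_quotient_imp_non_empty[OF equiv_unitary_equiv X] by blast
    then have "d a a = 0"
      using zero_iff sub X by blast
    then show "unitary_residual d X Y = 0"
      \<comment> \<open>The pair \<open>a\<close>, \<open>a\<close> bounds the minimum above by
        \<open>0\<close>; nonnegativity bounds it below.\<close>
      using unitary_residual_le[OF attained X Y a, of a] pos[OF X Y] a \<open>X = Y\<close> by simp
  qed
  have "metric_on ?Q (unitary_residual d)" if m: "metric_on density_operators d"
    unfolding metric_on_def
  proof (intro conjI ballI)
    show "unitary_residual d X Y = unitary_residual d Y X" if "X \<in> ?Q" "Y \<in> ?Q" for X Y
      using m by (intro unitary_residual_commute attained that) (auto simp: metric_on_def)
    show "unitary_residual d X Z \<le> unitary_residual d X Y + unitary_residual d Y Z"
      if "X \<in> ?Q" "Y \<in> ?Q" "Z \<in> ?Q" for X Y Z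
      using m by (intro unitary_residual_triangle invariant attained that)
        (auto simp: metric_on_def)
  qed (use pos zero in blast)+
  then show ?thesis
    using pos zero by (simp add: quotientI)
qed

end
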